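(* If $\mathbb{S}(I)$ is a subgroup of the symmetric group $\mathrm{Sym}(I)$, then the semigroup $T_{\mathbb{S}(I)}(X,\mathcal{P})$ is regular.
   Context: $X$ is a nonempty set (possibly infinite) and $\mathcal{P}=\{X_i : i\in I\}$ is a partition of $X$ into nonempty blocks, with $X_i\cap X_j=\varnothing$ for $i\neq j$. $T(Z)$ denotes the semigroup of all maps $Z\to Z$ under composition, and $\mathrm{Sym}(Z)$ is the group of all bijections $Z\to Z$. Maps are written on the right and composed from left to right: $x(fg)=(xf)g$; $Af=\{af: a\in A\}$. $T(X,\mathcal{P})$ is the subsemigroup of all $f\in T(X)$ such that for every $i\in I$ there is $j\in I$ with $X_if\subseteq X_j$. For $f\in T(X,\mathcal{P})$ the character $\chi^{(f)}\in T(I)$ is defined by $i\chi^{(f)}=j$ whenever $X_if\subseteq X_j$. For a subsemigroup $\mathbb{S}(I)$ of $T(I)$, $T_{\mathbb{S}(I)}(X,\mathcal{P})=\{f\in T(X,\mathcal{P}): \chi^{(f)}\in \mathbb{S}(I)\}$, a subsemigroup of $T(X,\mathcal{P})$. A semigroup $S$ is regular if for every $a\in S$ there is $b\in S$ with $aba=a$. *)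

theory Defs
  imports "HOL-Library.FuncSet" "HOL-Library.Disjoint_Sets" "HOL-Algebra.Bij"
begin

text \<open>
  Maps \<open>Z \<rightarrow> Z\<close> on a carrier set are represented by extensional functions, so that two maps are
  equal as soon as they agree on \<open>Z\<close>. Maps are composed from left to right.
\<close>

definition full_transf :: "'a set \<Rightarrow> ('a \<Rightarrow> 'a) set" where
  "full_transf Z = Z \<rightarrow>\<^sub>E Z"

definition rcomp :: "'a set \<Rightarrow> ('a \<Rightarrow> 'a) \<Rightarrow> ('a \<Rightarrow> 'a) \<Rightarrow> ('a \<Rightarrow> 'a)" where
  "rcomp Z f g = compose Z g f"

locale carrier_semigroup =
  fixes S :: "'s set" and mul :: "'s \<Rightarrow> 's \<Rightarrow> 's"
  assumes closed: "\<lbrakk>a \<in> S; b \<in> S\<rbrakk> \<Longrightarrow> mul a b \<in> S"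
    and assoc: "\<lbrakk>a \<in> S; b \<in> S; c \<in> S\<rbrakk> \<Longrightarrow> mul (mul a b) c = mul a (mul b c)"

definition regular_semigroup :: "'s set \<Rightarrow> ('s \<Rightarrow> 's \<Rightarrow> 's) \<Rightarrow> bool" where
  "regular_semigroup S mul \<longleftrightarrow>
     carrier_semigroup S mul \<and> (\<forall>a\<in>S. \<exists>b\<in>S. mul (mul a b) a = a)"

text \<open>
  Disjointness of the family (and not only of its range) makes \<open>i \<mapsto> B i\<close> injective on \<open>I\<close>.
\<close>

definition indexed_partition :: "'a set \<Rightarrow> 'i set \<Rightarrow> ('i \<Rightarrow> 'a set) \<Rightarrow> bool" where
  "indexed_partition X I B \<longleftrightarrow> partition_on X (B ` I) \<and> disjoint_family_on B I"

definition block_transf :: "'a set \<Rightarrow> 'i set \<Rightarrow> ('i \<Rightarrow> 'a set) \<Rightarrow> ('a \<Rightarrow> 'a) set" where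
  "block_transf X I B = {f \<in> full_transf X. \<forall>i\<in>I. \<exists>j\<in>I. f ` B i \<subseteq> B j}"

text \<open>
  The index \<open>j\<close> below is unique when \<open>B\<close> is an indexed partition and \<open>f \<in> block_transf X I B\<close>.
\<close>

definition character :: "'i set \<Rightarrow> ('i \<Rightarrow> 'a set) \<Rightarrow> ('a \<Rightarrow> 'a) \<Rightarrow> ('i \<Rightarrow> 'i)" where
  "character I B f = (\<lambda>i\<in>I. THE j. j \<in> I \<and> f ` B i \<subseteq> B j)"

definition block_transf_char ::
    "'a set \<Rightarrow> 'i set \<Rightarrow> ('i \<Rightarrow> 'a set) \<Rightarrow> ('i \<Rightarrow> 'i) set \<Rightarrow> ('a \<Rightarrow> 'a) set" where
  "block_transf_char X I B S = {f \<in> block_transf X I B. character I B f \<in> S}"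

end

theory Submission
  imports Defs
begin

text \<open>
  Passing to characters is a homomorphism into the maps on \<open>I\<close>, so the maps with character in \<open>S\<close>
  are closed under composition. For regularity, let \<open>a\<close> have character \<open>s \<in> S\<close>. As \<open>s\<close> permutes
  \<open>I\<close>, each block \<open>B j\<close> receives the image of exactly one block, \<open>B i\<close> with \<open>s i = j\<close>, and a
  preimage under \<open>a\<close> of a point of \<open>B j\<close>, if there is one at all, can only lie in \<open>B i\<close>. Hence
  there is a map \<open>b\<close> that sends each point of \<open>B j\<close> into \<open>B i\<close>, and to a preimage under \<open>a\<close>
  whenever one exists. Then \<open>aba = a\<close>, and the character of \<open>b\<close> is the inverse of \<open>s\<close>, which
  belongs to the group \<open>S\<close>.
\<close>

lemma indexed_partition_Union: "indexed_partition X I B \<Longrightarrow> (\<Union>i\<in>I. B i) = X"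
  by (auto simp: indexed_partition_def partition_on_def)

lemma indexed_partition_nonempty: "\<lbrakk>indexed_partition X I B; i \<in> I\<rbrakk> \<Longrightarrow> B i \<noteq> {}"
  by (auto simp: indexed_partition_def partition_on_def)

lemma indexed_partition_unique:
  "\<lbrakk>indexed_partition X I B; i \<in> I; j \<in> I; x \<in> B i; x \<in> B j\<rbrakk> \<Longrightarrow> i = j"
  by (auto simp: indexed_partition_def disjoint_family_on_def)

lemma character_eqI:
  assumes P: "indexed_partition X I B" and "i \<in> I" "j \<in> I" "f ` B i \<subseteq> B j"
  shows "character I B f i = j"
proof -
  obtain x where "x \<in> B i"
    using indexed_partition_nonempty[OF P \<open>i \<in> I\<close>] by blast
  have unique: "k = j" if "k \<in> I" "f ` B i \<subseteq> B k" for k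
  proof (rule indexed_partition_unique[OF P \<open>k \<in> I\<close> \<open>j \<in> I\<close>])
    show "f x \<in> B k" "f x \<in> B j"
      using \<open>x \<in> B i\<close> \<open>f ` B i \<subseteq> B k\<close> \<open>f ` B i \<subseteq> B j\<close> by auto
  qed
  have "(THE k. k \<in> I \<and> f ` B i \<subseteq> B k) = j"
  proof (rule the_equality)
    show "j \<in> I \<and> f ` B i \<subseteq> B j"
      using assms by blast
  qed (elim conjE, rule unique)
  then show ?thesis
    using \<open>i \<in> I\<close> by (simp add: character_def)
qed

lemma character_in_index:
  assumes "indexed_partition X I B" "f \<in> block_transf X I B" "i \<in> I"
  shows "character I B f i \<in> I"
proof -
  obtain j where "j \<in> I" "f ` B i \<subseteq> B j"
    using assms by (auto simp: block_transf_def)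
  then show ?thesis
    using character_eqI[OF assms(1) assms(3)] by metis
qed

lemma image_block_subset_character:
  assumes "indexed_partition X I B" "f \<in> block_transf X I B" "i \<in> I"
  shows "f ` B i \<subseteq> B (character I B f i)"
proof -
  obtain j where "j \<in> I" "f ` B i \<subseteq> B j"
    using assms by (auto simp: block_transf_def)
  then show ?thesis
    using character_eqI[OF assms(1) assms(3)] by metis
qed

lemma character_eq_extensionalI:
  assumes P: "indexed_partition X I B" and "t \<in> extensional I"
    and "\<And>i. i \<in> I \<Longrightarrow> t i \<in> I" and "\<And>i. i \<in> I \<Longrightarrow> f ` B i \<subseteq> B (t i)"
  shows "character I B f = t"
proof (rule extensionalityI)
  show "character I B f \<in> extensional I"
    by (simp add: character_def)
qed (use assms character_eqI[OF P] in auto)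

lemma rcomp_image_block_subset:
  assumes P: "indexed_partition X I B"
    and f: "f \<in> block_transf X I B" and g: "g \<in> block_transf X I B" and "i \<in> I"
  shows "rcomp X f g ` B i \<subseteq> B (character I B g (character I B f i))"
proof -
  have "B i \<subseteq> X"
    using indexed_partition_Union[OF P] \<open>i \<in> I\<close> by blast
  then show ?thesis
    using image_block_subset_character[OF P f \<open>i \<in> I\<close>]
      image_block_subset_character[OF P g character_in_index[OF P f \<open>i \<in> I\<close>]]
    by (auto simp: rcomp_def compose_def)
qed

lemma rcomp_block_transf:
  assumes P: "indexed_partition X I B"
    and f: "f \<in> block_transf X I B" and g: "g \<in> block_transf X I B"
  shows "rcomp X f g \<in> block_transf X I B"
proof -
  have "rcomp X f g \<in> full_transf X"
    using f g by (auto simp: block_transf_def full_transf_def rcomp_def compose_def)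
  moreover have "\<exists>j\<in>I. rcomp X f g ` B i \<subseteq> B j" if "i \<in> I" for i
    using rcomp_image_block_subset[OF P f g that]
      character_in_index[OF P g character_in_index[OF P f that]] by (rule bexI)
  ultimately show ?thesis
    by (simp add: block_transf_def)
qed

lemma character_rcomp:
  assumes P: "indexed_partition X I B"
    and f: "f \<in> block_transf X I B" and g: "g \<in> block_transf X I B"
  shows "character I B (rcomp X f g) = compose I (character I B g) (character I B f)"
proof (rule character_eq_extensionalI[OF P])
  fix i assume "i \<in> I"
  then show "compose I (character I B g) (character I B f) i \<in> I"
    using character_in_index[OF P] f g by (simp add: compose_eq)
  show "rcomp X f g ` B i \<subseteq> B (compose I (character I B g) (character I B f) i)"
    using rcomp_image_block_subset[OF P f g \<open>i \<in> I\<close>] \<open>i \<in> I\<close> by (simp add: compose_eq)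
qed simp

lemma carrier_semigroup_block_transf_char:
  assumes P: "indexed_partition X I B"
    and S: "\<And>s t. \<lbrakk>s \<in> S; t \<in> S\<rbrakk> \<Longrightarrow> compose I t s \<in> S"
  shows "carrier_semigroup (block_transf_char X I B S) (rcomp X)"
proof
  fix f g assume "f \<in> block_transf_char X I B S" "g \<in> block_transf_char X I B S"
  then show "rcomp X f g \<in> block_transf_char X I B S"
    using rcomp_block_transf[OF P] character_rcomp[OF P] S by (simp add: block_transf_char_def)
next
  fix f g h assume "f \<in> block_transf_char X I B S"
  then have "f \<in> X \<rightarrow> X"
    by (auto simp: block_transf_char_def block_transf_def full_transf_def)
  then show "rcomp X (rcomp X f g) h = rcomp X f (rcomp X g h)"
    by (simp add: rcomp_def compose_assoc)
qed

text \<open>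
  The map \<open>t\<close> names, for each block \<open>B j\<close>, the block \<open>B (t j)\<close> into which \<open>b\<close> sends it. That \<open>t\<close>
  is a left inverse of the character of \<open>a\<close> makes this the right block: for \<open>x\<close> in \<open>B i\<close>, the
  value \<open>b (a x)\<close> is sought in \<open>B i\<close> itself, so a preimage of \<open>a x\<close> is found there. Points of
  \<open>B j\<close> that are not values of \<open>a\<close> on \<open>B (t j)\<close> may go anywhere in \<open>B (t j)\<close>.
\<close>

lemma block_transf_inner_inverse:
  assumes P: "indexed_partition X I B" and a: "a \<in> block_transf X I B"
    and t_ext: "t \<in> extensional I" and t_in: "\<And>j. j \<in> I \<Longrightarrow> t j \<in> I"
    and t_left: "\<And>i. i \<in> I \<Longrightarrow> t (character I B a i) = i"
  obtains b where "b \<in> block_transf X I B" "character I B b = t"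
    "rcomp X (rcomp X a b) a = a"
proof -
  \<comment> \<open>The block is quantified inside, so that the choice of \<open>c\<close> depends on the point alone.\<close>
  have "\<exists>z. \<forall>j\<in>I. y \<in> B j \<longrightarrow> z \<in> B (t j) \<and> (y \<in> a ` B (t j) \<longrightarrow> a z = y)"
    if "y \<in> X" for y
  proof -
    obtain j where j: "j \<in> I" "y \<in> B j"
      using indexed_partition_Union[OF P] \<open>y \<in> X\<close> by blast
    obtain z where z: "z \<in> B (t j)" "y \<in> a ` B (t j) \<longrightarrow> a z = y"
      using indexed_partition_nonempty[OF P t_in[OF \<open>j \<in> I\<close>]] by blast
    have "k = j" if "k \<in> I" "y \<in> B k" for k
      using indexed_partition_unique[OF P] j that by blast
    then show ?thesis
      using z by blast
  qed
  then have "\<exists>c. \<forall>y\<in>X. \<forall>j\<in>I. y \<in> B j \<longrightarrow>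
      c y \<in> B (t j) \<and> (y \<in> a ` B (t j) \<longrightarrow> a (c y) = y)"
    by (intro bchoice ballI)
  then obtain c where c: "\<And>y j. \<lbrakk>y \<in> X; j \<in> I; y \<in> B j\<rbrakk> \<Longrightarrow>
      c y \<in> B (t j) \<and> (y \<in> a ` B (t j) \<longrightarrow> a (c y) = y)"
    by blast
  define b where "b = restrict c X"
  have B_sub: "B i \<subseteq> X" if "i \<in> I" for i
    using indexed_partition_Union[OF P] that by blast
  have b_block: "b ` B j \<subseteq> B (t j)" if "j \<in> I" for j
    using c that B_sub[OF that] by (auto simp: b_def)
  have "b \<in> full_transf X"
    unfolding full_transf_def b_def
  proof (rule restrict_PiE_iff[THEN iffD2], rule ballI)
    fix y assume "y \<in> X"
    then obtain j where "j \<in> I" "y \<in> B j"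
      using indexed_partition_Union[OF P] by blast
    then show "c y \<in> X"
      using c \<open>y \<in> X\<close> B_sub t_in by blast
  qed
  moreover have "\<exists>k\<in>I. b ` B j \<subseteq> B k" if "j \<in> I" for j
    using b_block[OF that] t_in[OF that] by (rule bexI)
  ultimately have b: "b \<in> block_transf X I B"
    by (simp add: block_transf_def)
  have "rcomp X (rcomp X a b) a = a"
  proof (rule extensionalityI)
    show "rcomp X (rcomp X a b) a \<in> extensional X"
      by (simp add: rcomp_def)
    show "a \<in> extensional X"
      using a by (simp add: block_transf_def full_transf_def PiE_def)
    fix x assume "x \<in> X"
    then obtain i where i: "i \<in> I" "x \<in> B i"
      using indexed_partition_Union[OF P] by blast
    let ?j = "character I B a i"
    have j: "?j \<in> I" "a x \<in> B ?j"
      using character_in_index[OF P a] image_block_subset_character[OF P a] i by auto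
    then have "a x \<in> X"
      using B_sub by blast
    moreover have "a x \<in> a ` B (t ?j)"
      using i t_left by simp
    ultimately have "a (b (a x)) = a x"
      using c j by (simp add: b_def)
    then show "rcomp X (rcomp X a b) a x = a x"
      using \<open>x \<in> X\<close> by (simp add: rcomp_def compose_eq)
  qed
  with b character_eq_extensionalI[OF P t_ext t_in b_block] show thesis
    by (rule that)
qed

theorem corollary3p6:
  fixes X :: "'a set" and I :: "'i set" and B :: "'i \<Rightarrow> 'a set" and S :: "('i \<Rightarrow> 'i) set"
  assumes "X \<noteq> {}"
    and "indexed_partition X I B"
    and "subgroup S (BijGroup I)"
  shows "regular_semigroup (block_transf_char X I B S) (rcomp X)"
proof -
  note P = assms(2)
  interpret S: subgroup S "BijGroup I"
    by fact
  have S_Bij: "s \<in> Bij I" if "s \<in> S" for s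
    using S.subset that by (auto simp: BijGroup_def)
  have "compose I t s \<in> S" if "s \<in> S" "t \<in> S" for s t
    using S.m_closed[OF that(2,1)] S_Bij that by (simp add: BijGroup_def)
  then have "carrier_semigroup (block_transf_char X I B S) (rcomp X)"
    by (rule carrier_semigroup_block_transf_char[OF P])
  moreover have "\<exists>b\<in>block_transf_char X I B S. rcomp X (rcomp X a b) a = a"
    if "a \<in> block_transf_char X I B S" for a
  proof -
    let ?s = "character I B a"
    let ?t = "\<lambda>i\<in>I. inv_into I ?s i"
    have a: "a \<in> block_transf X I B" and "?s \<in> S"
      using that by (auto simp: block_transf_char_def)
    then have s: "bij_betw ?s I I"
      using S_Bij by (auto simp: Bij_def)
    have "?t \<in> S"
      using S.m_inv_closed[OF \<open>?s \<in> S\<close>] inv_BijGroup[OF S_Bij[OF \<open>?s \<in> S\<close>]] by simp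
    have "?t j \<in> I" if "j \<in> I" for j
      using s that by (simp add: bij_betw_def inv_into_into)
    moreover have "?t (?s i) = i" if "i \<in> I" for i
      using s that character_in_index[OF P a that] by (simp add: bij_betw_def)
    ultimately obtain b where "b \<in> block_transf X I B" "character I B b = ?t"
      "rcomp X (rcomp X a b) a = a"
      by (rule block_transf_inner_inverse[OF P a restrict_extensional])
    then show ?thesis
      using \<open>?t \<in> S\<close> by (auto simp: block_transf_char_def)
  qed
  ultimately show ?thesis
    by (simp add: regular_semigroup_def)
qed

end
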